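(* Let $(\gamma^j, s_3^j, s_{i,5}^j, k^j)$ and $V^j$, $j=1,\dots,N_{iter}$, be produced by the iterative algorithm described in the context (alternating a $\gamma$-step and a $V$-step, started from $V^0$). Then the backward-reachable-set inner-approximation from the $(j+1)$'th $\gamma$-step contains the inner-approximation from the $j$'th $V$-step: $$\Omega_{t_0, \gamma^{j}}^{V^{j}} \subseteq \Omega_{t_0, \gamma^{j+1}}^{V^{j}}.$$
   Context: Notation: $\mathbb{R}[\xi]$ is the set of real polynomials in $\xi$, $\mathbb{R}^m[\xi]$ and $\mathbb{R}^{m\times p}[\xi]$ are the vector- and matrix-valued ones, and $\Sigma[\xi]\subset\mathbb{R}[\xi]$ is the set of sum-of-squares polynomials. For $V:\mathbb{R}\times\mathbb{R}^n\to\mathbb{R}$ and $\eta\in\mathbb{R}$, $\Omega_{t,\eta}^V := \{x\in\mathbb{R}^n : V(t,x)\le\eta\}$. Data: the polynomial system $\dot x = f(t,x)+g(t,x)u$ with $f\in\mathbb{R}^n[t,x]$, $g\in\mathbb{R}^{n\times m}[t,x]$; times $t_0\le T$; $h(t):=(t-t_0)(T-t)$; a polynomial $r\in\mathbb{R}[t,x]$; $A\in\mathbb{R}^{n_p\times m}[t,x]$ with rows $A_i$, and $b\in\mathbb{R}^{n_p}[t,x]$ with entries $b_i$ (control constraints $A(t,x)u\le b(t,x)$); and a fixed $\epsilon>0$. Constraints. The variables are $V\in\mathbb{R}[t,x]$, $k\in\mathbb{R}^m[t,x]$, $\gamma\in\mathbb{R}$, and multipliers $s_2, s_3, s_4-\epsilon,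 s_7\in\Sigma[t,x]$ and $s_{i,5}, s_{i,6}\in\Sigma[t,x]$ for $i=1,\dots,n_p$. The constraints, called (E.2)-(E.4), are: (E.2) $-\left(\frac{\partial V}{\partial t} + \frac{\partial V}{\partial x}(f + gk) \right) - s_2 h +s_3(V - \gamma ) \in \Sigma[t,x]$; (E.3) $-s_4 r + V - \gamma - s_7 h \in \Sigma[t, x]$; (E.4) $b_i - A_i k + s_{i,5}(V - \gamma) - s_{i,6}h \in \Sigma[t,x]$ for all $i=1,\dots,n_p$. Algorithm. The input is a function $V^0\in\mathbb{R}[t,x]$ such that (E.2)-(E.4) with $V=V^0$ are feasible for a proper choice of $s,k,\gamma$. For $j=1,\dots,N_{iter}$: $\gamma$-step: with $V=V^{j-1}$ fixed, maximize $\gamma$ over the decision variables $(s,k,\gamma)$ (where $s$ stands for all the multipliers $s_2,s_3,s_4,s_{i,5},s_{i,6},s_7$) subject to (E.2)-(E.4). This yields $(s_3^j, s_{i,5}^j, k^j)$ and the optimal value $\gamma^j$. $V$-step: with $\gamma=\gamma^j$, $s_3=s_3^j$, $s_{i,5}=s_{i,5}^j$, $k=k^j$ fixed, the decision variables are $(s_1,s_2,s_4,s_{i,6},s_7,V)$. Choose a feasible point (the analytic center of the feasible set) subject to (E.2)-(E.4), $s_1(x)\in\Sigma[x]$, and $-(V(t_0,x)-\gamma^j)+s_1(x)(V^{j-1}(t_0,x)-\gamma^j)\in\Sigma[x]$. This yields $V^j$. The inner-approximation from the $j$'th $V$-step is $\Omega_{t_0,\gamma^j}^{V^j}$, and the one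 from the $(j+1)$'th $\gamma$-step is $\Omega_{t_0,\gamma^{j+1}}^{V^j}$. *)

theory Defs
  imports "HOL-Analysis.Analysis"
begin

text \<open>
  Polynomials are represented by the polynomial functions they induce, using the library
  predicates \<^const>\<open>real_polynomial_function\<close> and \<^const>\<open>polynomial_function\<close> (the latter also
  for vector- and matrix-valued functions). Over the reals this representation is faithful,
  since a polynomial is determined by its values.
\<close>

type_synonym 'n tx = "real \<times> (real, 'n) vec"

definition sos :: "('a::real_normed_vector \<Rightarrow> real) \<Rightarrow> bool" where
  "sos p \<longleftrightarrow> (\<exists>qs. (\<forall>q\<in>set qs. real_polynomial_function q) \<and> p = (\<lambda>z. \<Sum>q\<leftarrow>qs. (q z)\<^sup>2))"

definition sublevel :: "('n tx \<Rightarrow> real) \<Rightarrow> real \<Rightarrow> real \<Rightarrow> (real ^ 'n) set" where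
  "sublevel V t \<eta> = {x. V (t, x) \<le> \<eta>}"

definition partial_t :: "('n tx \<Rightarrow> real) \<Rightarrow> 'n tx \<Rightarrow> real" where
  "partial_t V = (\<lambda>(t, x). deriv (\<lambda>\<tau>. V (\<tau>, x)) t)"

definition partial_x :: "('n tx \<Rightarrow> real) \<Rightarrow> 'n tx \<Rightarrow> real ^ 'n" where
  "partial_x V = (\<lambda>(t, x). \<chi> i. deriv (\<lambda>\<xi>. V (t, \<chi> j. if j = i then \<xi> else x $ j)) (x $ i))"

definition hfun :: "real \<Rightarrow> real \<Rightarrow> 'n tx \<Rightarrow> real" where
  "hfun t0 T = (\<lambda>(t, x). (t - t0) * (T - t))"

definition E2 ::
  "('n tx \<Rightarrow> real ^ 'n) \<Rightarrow> ('n tx \<Rightarrow> real ^ 'm ^ 'n) \<Rightarrow> real \<Rightarrow> real \<Rightarrow>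
   ('n tx \<Rightarrow> real) \<Rightarrow> ('n tx \<Rightarrow> real ^ 'm) \<Rightarrow> real \<Rightarrow>
   ('n tx \<Rightarrow> real) \<Rightarrow> ('n tx \<Rightarrow> real) \<Rightarrow> bool" where
  "E2 f g t0 T V k \<gamma> s2 s3 \<longleftrightarrow>
     sos (\<lambda>z. - (partial_t V z + partial_x V z \<bullet> (f z + g z *v k z))
              - s2 z * hfun t0 T z + s3 z * (V z - \<gamma>))"

definition E3 ::
  "real \<Rightarrow> real \<Rightarrow> (('n::finite) tx \<Rightarrow> real) \<Rightarrow> ('n tx \<Rightarrow> real) \<Rightarrow> real \<Rightarrow>
   ('n tx \<Rightarrow> real) \<Rightarrow> ('n tx \<Rightarrow> real) \<Rightarrow> bool" where
  "E3 t0 T r V \<gamma> s4 s7 \<longleftrightarrow>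
     sos (\<lambda>z. - s4 z * r z + V z - \<gamma> - s7 z * hfun t0 T z)"

definition E4 ::
  "real \<Rightarrow> real \<Rightarrow> (('n::finite) tx \<Rightarrow> real ^ 'm ^ 'p) \<Rightarrow> ('n tx \<Rightarrow> real ^ 'p) \<Rightarrow>
   ('n tx \<Rightarrow> real) \<Rightarrow> ('n tx \<Rightarrow> real ^ 'm) \<Rightarrow> real \<Rightarrow>
   ('p \<Rightarrow> 'n tx \<Rightarrow> real) \<Rightarrow> ('p \<Rightarrow> 'n tx \<Rightarrow> real) \<Rightarrow> bool" where
  "E4 t0 T A b V k \<gamma> s5 s6 \<longleftrightarrow>
     (\<forall>i. sos (\<lambda>z. b z $ i - (A z *v k z) $ i + s5 i z * (V z - \<gamma>) - s6 i z * hfun t0 T z))"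

definition feasible ::
  "('n tx \<Rightarrow> real ^ 'n) \<Rightarrow> ('n tx \<Rightarrow> real ^ 'm ^ 'n) \<Rightarrow> real \<Rightarrow> real \<Rightarrow>
   ('n tx \<Rightarrow> real) \<Rightarrow>
   ('n tx \<Rightarrow> real ^ 'm ^ 'p) \<Rightarrow> ('n tx \<Rightarrow> real ^ 'p) \<Rightarrow> real \<Rightarrow>
   ('n tx \<Rightarrow> real) \<Rightarrow> ('n tx \<Rightarrow> real ^ 'm) \<Rightarrow> real \<Rightarrow>
   ('n tx \<Rightarrow> real) \<Rightarrow> ('n tx \<Rightarrow> real) \<Rightarrow> ('n tx \<Rightarrow> real) \<Rightarrow>
   ('p \<Rightarrow> 'n tx \<Rightarrow> real) \<Rightarrow> ('p \<Rightarrow> 'n tx \<Rightarrow> real) \<Rightarrow>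
   ('n tx \<Rightarrow> real) \<Rightarrow> bool" where
  "feasible f g t0 T r A b \<epsilon> V k \<gamma> s2 s3 s4 s5 s6 s7 \<longleftrightarrow>
     real_polynomial_function V \<and> polynomial_function k \<and>
     sos s2 \<and> sos s3 \<and> sos (\<lambda>z. s4 z - \<epsilon>) \<and> sos s7 \<and>
     (\<forall>i. sos (s5 i)) \<and> (\<forall>i. sos (s6 i)) \<and>
     E2 f g t0 T V k \<gamma> s2 s3 \<and> E3 t0 T r V \<gamma> s4 s7 \<and> E4 t0 T A b V k \<gamma> s5 s6"

text \<open>
  The next two predicates relate the input of a step to the part of its outcome that the
  algorithm passes on; the remaining multipliers are existentially quantified.
  The optimum in the \<open>\<gamma>\<close>-step is attained.
\<close>

definition gamma_step ::
  "('n tx \<Rightarrow> real ^ 'n) \<Rightarrow> ('n tx \<Rightarrow> real ^ 'm ^ 'n) \<Rightarrow> real \<Rightarrow> real \<Rightarrow>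
   ('n tx \<Rightarrow> real) \<Rightarrow>
   ('n tx \<Rightarrow> real ^ 'm ^ 'p) \<Rightarrow> ('n tx \<Rightarrow> real ^ 'p) \<Rightarrow> real \<Rightarrow>
   ('n tx \<Rightarrow> real) \<Rightarrow>
   real \<Rightarrow> ('n tx \<Rightarrow> real) \<Rightarrow> ('p \<Rightarrow> 'n tx \<Rightarrow> real) \<Rightarrow>
   ('n tx \<Rightarrow> real ^ 'm) \<Rightarrow> bool" where
  "gamma_step f g t0 T r A b \<epsilon> V \<gamma> s3 s5 k \<longleftrightarrow>
     (\<exists>s2 s4 s6 s7. feasible f g t0 T r A b \<epsilon> V k \<gamma> s2 s3 s4 s5 s6 s7) \<and>
     (\<forall>k' \<gamma>' s2' s3' s4' s5' s6' s7'.
        feasible f g t0 T r A b \<epsilon> V k' \<gamma>' s2' s3' s4' s5' s6' s7' \<longrightarrow> \<gamma>' \<le> \<gamma>)"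

text \<open>
  Every feasible point is admitted as outcome of a \<open>V\<close>-step, which covers every rule for selecting
  one, such as the analytic center. \<open>V\<close> is the previous iterate and \<open>V'\<close> the new one.
\<close>

definition V_step ::
  "('n tx \<Rightarrow> real ^ 'n) \<Rightarrow> ('n tx \<Rightarrow> real ^ 'm ^ 'n) \<Rightarrow> real \<Rightarrow> real \<Rightarrow>
   ('n tx \<Rightarrow> real) \<Rightarrow>
   ('n tx \<Rightarrow> real ^ 'm ^ 'p) \<Rightarrow> ('n tx \<Rightarrow> real ^ 'p) \<Rightarrow> real \<Rightarrow>
   ('n tx \<Rightarrow> real) \<Rightarrow>
   real \<Rightarrow> ('n tx \<Rightarrow> real) \<Rightarrow> ('p \<Rightarrow> 'n tx \<Rightarrow> real) \<Rightarrow>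
   ('n tx \<Rightarrow> real ^ 'm) \<Rightarrow> ('n tx \<Rightarrow> real) \<Rightarrow> bool" where
  "V_step f g t0 T r A b \<epsilon> V \<gamma> s3 s5 k V' \<longleftrightarrow>
     (\<exists>s1 s2 s4 s6 s7.
        feasible f g t0 T r A b \<epsilon> V' k \<gamma> s2 s3 s4 s5 s6 s7 \<and>
        sos s1 \<and> sos (\<lambda>x. - (V' (t0, x) - \<gamma>) + s1 x * (V (t0, x) - \<gamma>)))"

text \<open>
  The sequences \<open>V\<close> and \<open>\<gamma>\<close>, \<open>s3\<close>, \<open>s5\<close>, \<open>k\<close> are indexed by the iteration number; only
  \<open>V 0, \<dots>, V N\<close> and the values of the others at \<open>1, \<dots>, N\<close> are relevant.
\<close>

definition algorithm_run ::
  "('n tx \<Rightarrow> real ^ 'n) \<Rightarrow> ('n tx \<Rightarrow> real ^ 'm ^ 'n) \<Rightarrow> real \<Rightarrow> real \<Rightarrow>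
   ('n tx \<Rightarrow> real) \<Rightarrow>
   ('n tx \<Rightarrow> real ^ 'm ^ 'p) \<Rightarrow> ('n tx \<Rightarrow> real ^ 'p) \<Rightarrow> real \<Rightarrow> nat \<Rightarrow>
   (nat \<Rightarrow> 'n tx \<Rightarrow> real) \<Rightarrow>
   (nat \<Rightarrow> real) \<Rightarrow> (nat \<Rightarrow> 'n tx \<Rightarrow> real) \<Rightarrow>
   (nat \<Rightarrow> 'p \<Rightarrow> 'n tx \<Rightarrow> real) \<Rightarrow> (nat \<Rightarrow> 'n tx \<Rightarrow> real ^ 'm) \<Rightarrow> bool" where
  "algorithm_run f g t0 T r A b \<epsilon> N V \<gamma> s3 s5 k \<longleftrightarrow>
     (\<exists>k\<^sub>0 \<gamma>\<^sub>0 s2 s3\<^sub>0 s4 s5\<^sub>0 s6 s7.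
        feasible f g t0 T r A b \<epsilon> (V 0) k\<^sub>0 \<gamma>\<^sub>0 s2 s3\<^sub>0 s4 s5\<^sub>0 s6 s7) \<and>
     (\<forall>j\<in>{1..N}.
        gamma_step f g t0 T r A b \<epsilon> (V (j - 1)) (\<gamma> j) (s3 j) (s5 j) (k j) \<and>
        V_step f g t0 T r A b \<epsilon> (V (j - 1)) (\<gamma> j) (s3 j) (s5 j) (k j) (V j))"

end

theory Submission
  imports Defs
begin

text \<open>
  The outcome of the \<open>j\<close>-th \<open>V\<close>-step, together with \<open>\<gamma> j\<close> and the multipliers carried along, is a
  feasible point of the \<open>(j + 1)\<close>-th \<open>\<gamma>\<close>-step. Hence the optimal value does not decrease, and
  sublevel sets grow with the level.
\<close>

theorem theorem2:
  fixes f :: "'n tx \<Rightarrow> real ^ 'n"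
    and g :: "'n tx \<Rightarrow> real ^ 'm ^ 'n"
    and t0 T \<epsilon> :: real
    and r :: "'n tx \<Rightarrow> real"
    and A :: "'n tx \<Rightarrow> real ^ 'm ^ 'p"
    and b :: "'n tx \<Rightarrow> real ^ 'p"
    and N j :: nat
    and V :: "nat \<Rightarrow> 'n tx \<Rightarrow> real"
    and \<gamma> :: "nat \<Rightarrow> real"
    and s3 :: "nat \<Rightarrow> 'n tx \<Rightarrow> real"
    and s5 :: "nat \<Rightarrow> 'p \<Rightarrow> 'n tx \<Rightarrow> real"
    and k :: "nat \<Rightarrow> 'n tx \<Rightarrow> real ^ 'm"
  assumes "polynomial_function f" and "polynomial_function g"
    and "t0 \<le> T"
    and "real_polynomial_function r"
    and "polynomial_function A" and "polynomial_function b"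
    and "\<epsilon> > 0"
    and "algorithm_run f g t0 T r A b \<epsilon> N V \<gamma> s3 s5 k"
    and "1 \<le> j" and "j + 1 \<le> N"
  shows "sublevel (V j) t0 (\<gamma> j) \<subseteq> sublevel (V j) t0 (\<gamma> (j + 1))"
proof -
  have run: "gamma_step f g t0 T r A b \<epsilon> (V (i - 1)) (\<gamma> i) (s3 i) (s5 i) (k i) \<and>
      V_step f g t0 T r A b \<epsilon> (V (i - 1)) (\<gamma> i) (s3 i) (s5 i) (k i) (V i)"
    if "1 \<le> i" "i \<le> N" for i
    using assms(8) that unfolding algorithm_run_def by simp
  \<comment> \<open>The input of step \<open>j + 1\<close> is \<open>V (j + 1 - 1)\<close>, that is
    \<open>V j\<close>; \<open>j + 1 \<le> N\<close> keeps this step within the run.\<close>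
  have "gamma_step f g t0 T r A b \<epsilon> (V j) (\<gamma> (j + 1)) (s3 (j + 1)) (s5 (j + 1)) (k (j + 1))"
    using run[of "j + 1"] assms(10) by simp
  then have max: "\<gamma>' \<le> \<gamma> (j + 1)"
    if "feasible f g t0 T r A b \<epsilon> (V j) k' \<gamma>' s2' s3' s4' s5' s6' s7'" for k' \<gamma>' s2' s3' s4' s5' s6' s7'
    using that unfolding gamma_step_def by blast
  \<comment> \<open>\<open>s3 j\<close>, \<open>s5 j\<close>, \<open>k j\<close> and
    \<open>\<gamma> j\<close> are fixed in the \<open>V\<close>-step but free in the next
    \<open>\<gamma>\<close>-step, so \<open>max\<close> accepts them although that step may return
    other values; \<open>s2\<close>, \<open>s4\<close>, \<open>s6\<close>, \<open>s7\<close> are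
    those found along with \<open>V j\<close>.\<close>
  from run[of j] assms(9,10) obtain s2 s4 s6 s7
    where "feasible f g t0 T r A b \<epsilon> (V j) (k j) (\<gamma> j) s2 (s3 j) s4 (s5 j) s6 s7"
    unfolding V_step_def by auto
  then have "\<gamma> j \<le> \<gamma> (j + 1)"
    by (rule max)
  then show ?thesis
    by (auto simp: sublevel_def)
qed

end
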